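(* For every integer $m\ge0$, the polynomial $$\mathcal{B}_{2m+2}(\phi)= -2^{2m+1}\sum_{k=0}^{m+1}(2\pi i)^{2k}\,\frac{B_{2k}}{(2k)!}\,\frac{B_{2m+2-2k}^{(2m+2)}(m+1)}{(2m+2-2k)!}\,\phi^{2m+2-2k}$$ vanishes at $\phi=2\pi i$ and at $\phi=-2\pi i$.
   Context: The Bernoulli numbers $B_n$ are defined by $\frac{x}{e^x-1}=\sum_{n\ge0}\frac{B_n}{n!}x^n$ for $|x|<2\pi$. For an integer $r\ge 0$ and real $t$, the generalized Bernoulli polynomials $B_n^{(r)}(t)$ are defined by $\frac{x^r}{(e^x-1)^r}e^{tx}=\sum_{n=0}^\infty \frac{B_n^{(r)}(t)}{n!}x^n$ for $|x|<2\pi$. *)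

theory Defs
  imports "HOL-Complex_Analysis.Complex_Analysis"
begin

text \<open>
  The exponential generating functions are read as formal power series. In the ring of formal
  power series over a field, \<open>fps_X / (fps_exp 1 - 1)\<close> is the quotient after cancelling the common
  factor \<open>fps_X\<close>, i.e. the Taylor series of \<open>x / (exp x - 1)\<close> with its removable singularity at 0
  filled in. The lemmas \<open>bernoulli_num_sums\<close> and \<open>gen_bernoulli_sums\<close> below confirm that the
  resulting series converge to the given functions for \<open>norm x < 2 * pi\<close>.
\<close>

definition bernoulli_num :: "nat \<Rightarrow> real" where
  "bernoulli_num n = fact n * fps_nth (fps_X / (fps_exp 1 - 1)) n"

definition gen_bernoulli :: "nat \<Rightarrow> nat \<Rightarrow> real \<Rightarrow> real" where
  "gen_bernoulli r n t = fact n * fps_nth ((fps_X / (fps_exp 1 - 1)) ^ r * fps_exp t) n"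

text \<open>
  The index is halved and shifted: \<open>calB m\<close> is the polynomial \<open>\<B>\<^bsub>2m+2\<^esub>\<close>.
\<close>

definition calB :: "nat \<Rightarrow> complex poly" where
  "calB m = smult (- (2 ^ (2 * m + 1)))
     (\<Sum>k = 0..m + 1.
        monom ((2 * of_real pi * \<i>) ^ (2 * k)
               * (of_real (bernoulli_num (2 * k)) / fact (2 * k))
               * (of_real (gen_bernoulli (2 * m + 2) (2 * m + 2 - 2 * k) (real m + 1))
                  / fact (2 * m + 2 - 2 * k)))
              (2 * m + 2 - 2 * k))"

lemma poly_calB:
  "poly (calB m) \<phi> = - (2 ^ (2 * m + 1)) *
     (\<Sum>k = 0..m + 1. (2 * of_real pi * \<i>) ^ (2 * k)
        * (of_real (bernoulli_num (2 * k)) / fact (2 * k))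
        * (of_real (gen_bernoulli (2 * m + 2) (2 * m + 2 - 2 * k) (real m + 1))
           / fact (2 * m + 2 - 2 * k))
        * \<phi> ^ (2 * m + 2 - 2 * k))"
  by (simp add: calB_def poly_sum poly_monom)

lemma subdegree_exp_minus_1: "subdegree (fps_exp 1 - 1 :: 'a :: field_char_0 fps) = 1"
  by (intro subdegreeI) auto

lemma fps_exp_minus_1_nonzero: "fps_exp 1 - 1 \<noteq> (0 :: 'a :: field_char_0 fps)"
  using subdegree_exp_minus_1[where 'a = 'a] by auto

lemma fps_bern_mult:
  "fps_X / (fps_exp 1 - 1) * (fps_exp 1 - 1) = (fps_X :: 'a :: field_char_0 fps)"
proof (rule dvd_div_mult_self)
  show "fps_exp 1 - 1 dvd (fps_X :: 'a fps)"
    using fps_exp_minus_1_nonzero fps_X_neq_zero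
    by (subst fps_dvd_iff) (simp_all only: subdegree_exp_minus_1 subdegree_fps_X order_refl)
qed

definition fps_cplx :: "real fps \<Rightarrow> complex fps" where
  "fps_cplx F = Abs_fps (\<lambda>n. of_real (fps_nth F n))"

lemma fps_cplx_mult: "fps_cplx (F * G) = fps_cplx F * fps_cplx G"
  by (simp add: fps_cplx_def fps_eq_iff fps_mult_nth)

lemma fps_cplx_power: "fps_cplx (F ^ r) = fps_cplx F ^ r"
proof (induction r)
  case 0
  show ?case by (auto simp: fps_cplx_def fps_eq_iff)
qed (simp add: fps_cplx_mult)

lemma fps_cplx_exp: "fps_cplx (fps_exp t) = fps_exp (of_real t)"
  by (simp add: fps_cplx_def fps_eq_iff)

lemma fps_cplx_bern: "fps_cplx (fps_X / (fps_exp 1 - 1)) = fps_X / (fps_exp 1 - 1)"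
proof -
  have "fps_cplx (fps_X / (fps_exp 1 - 1)) * fps_cplx (fps_exp 1 - 1) = fps_cplx fps_X"
    by (simp only: fps_cplx_mult[symmetric] fps_bern_mult)
  moreover have "fps_cplx (fps_exp 1 - 1) = fps_exp 1 - 1" "fps_cplx fps_X = fps_X"
    by (auto simp: fps_cplx_def fps_eq_iff)
  ultimately have "fps_cplx (fps_X / (fps_exp 1 - 1)) * (fps_exp 1 - 1) =
      fps_X / (fps_exp 1 - 1) * (fps_exp 1 - 1)"
    by (simp add: fps_bern_mult)
  thus ?thesis
    using fps_exp_minus_1_nonzero[where 'a = complex] by simp
qed

lemma exp_ne_1_in_disc:
  fixes z :: complex
  assumes "norm z < 2 * pi" "z \<noteq> 0"
  shows "exp z \<noteq> 1"
proof
  assume "exp z = 1"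
  then obtain n :: int where n: "Re z = 0" "Im z = of_int (2 * n) * pi"
    by (auto simp: exp_eq_1)
  have "n \<noteq> 0" using n assms(2) by (auto simp: complex_eq_iff)
  hence "1 \<le> \<bar>real_of_int n\<bar>" by linarith
  hence "2 * pi \<le> \<bar>Im z\<bar>" by (simp add: n abs_mult)
  also have "\<dots> \<le> norm z" by (rule abs_Im_le_cmod)
  finally show False using assms(1) by simp
qed

lemma
  fixes z :: complex
  shows fps_bern_conv_radius:
      "fps_conv_radius (fps_X / (fps_exp 1 - 1) :: complex fps) \<ge> 2 * pi"
    and eval_fps_bern: "norm z < 2 * pi \<Longrightarrow> z \<noteq> 0 \<Longrightarrow>
      eval_fps (fps_X / (fps_exp 1 - 1)) z = z / (exp z - 1)"
proof -
  have rad: "fps_conv_radius (fps_exp 1 - 1 :: complex fps) = \<infinity>"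
  proof -
    have "min (fps_conv_radius (fps_exp 1 :: complex fps)) (fps_conv_radius (1 :: complex fps))
        \<le> fps_conv_radius (fps_exp 1 - 1 :: complex fps)"
      by (rule fps_conv_radius_diff)
    thus ?thesis by simp
  qed
  have sub: "subdegree (fps_exp 1 - 1 :: complex fps) \<le> subdegree (fps_X :: complex fps)"
    by (simp only: subdegree_exp_minus_1 subdegree_fps_X order_refl)
  have ev: "eval_fps (fps_exp 1 - 1) w = exp w - 1" for w :: complex
    by (subst eval_fps_diff) auto
  have nz: "eval_fps (fps_exp 1 - 1) w \<noteq> 0"
    if "w \<in> eball 0 (ereal (2 * pi))" "w \<noteq> 0" for w :: complex
    using exp_ne_1_in_disc[of w] that by (auto simp: ev)
  have "Min {ereal (2 * pi), fps_conv_radius (fps_X :: complex fps),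
      fps_conv_radius (fps_exp 1 - 1 :: complex fps)}
      \<le> fps_conv_radius (fps_X / (fps_exp 1 - 1) :: complex fps)"
    using sub nz by (intro fps_conv_radius_divide) (simp_all only: rad, simp_all)
  thus "fps_conv_radius (fps_X / (fps_exp 1 - 1) :: complex fps) \<ge> 2 * pi"
    by (simp add: rad)
  assume z: "norm z < 2 * pi" "z \<noteq> 0"
  have "ereal (norm z) < Min {ereal (2 * pi), fps_conv_radius (fps_X :: complex fps),
      fps_conv_radius (fps_exp 1 - 1 :: complex fps)}"
    using z by (simp add: rad)
  hence "eval_fps (fps_X / (fps_exp 1 - 1)) z =
      (if z = 0 then fps_nth fps_X (subdegree (fps_exp 1 - 1 :: complex fps)) /
         fps_nth (fps_exp 1 - 1) (subdegree (fps_exp 1 - 1 :: complex fps))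
       else eval_fps fps_X z / eval_fps (fps_exp 1 - 1) z)"
    using sub nz by (intro eval_fps_divide) (simp_all only: rad, simp_all)
  thus "eval_fps (fps_X / (fps_exp 1 - 1)) z = z / (exp z - 1)"
    using z by (simp only: ev if_False) simp
qed

lemma gen_bernoulli_sums:
  fixes x :: complex
  assumes "norm x < 2 * pi" "x \<noteq> 0"
  shows "(\<lambda>n. of_real (gen_bernoulli r n t) / fact n * x ^ n) sums
           (x ^ r / (exp x - 1) ^ r * exp (of_real t * x))"
proof -
  define F :: "complex fps" where "F = fps_X / (fps_exp 1 - 1)"
  have x: "ereal (norm x) < fps_conv_radius F"
    unfolding F_def by (rule less_le_trans[OF _ fps_bern_conv_radius]) (use assms(1) in simp)
  have xr: "ereal (norm x) < fps_conv_radius (F ^ r)"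
    using x fps_conv_radius_power by (rule less_le_trans)
  have "ereal (norm x) < min (fps_conv_radius (F ^ r)) (fps_conv_radius (fps_exp (complex_of_real t)))"
    using xr by simp
  hence "ereal (norm x) < fps_conv_radius (F ^ r * fps_exp (of_real t))"
    using fps_conv_radius_mult by (rule less_le_trans)
  hence "(\<lambda>n. fps_nth (F ^ r * fps_exp (of_real t)) n * x ^ n) sums
      eval_fps (F ^ r * fps_exp (of_real t)) x"
    by (rule sums_eval_fps)
  moreover have "eval_fps (F ^ r * fps_exp (of_real t)) x =
      x ^ r / (exp x - 1) ^ r * exp (of_real t * x)"
    using x xr assms
    by (subst eval_fps_mult) (auto simp: eval_fps_power F_def eval_fps_bern power_divide)
  moreover have "F ^ r * fps_exp (of_real t) = 
      fps_cplx ((fps_X / (fps_exp 1 - 1)) ^ r * fps_exp t)"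
    by (simp only: fps_cplx_mult fps_cplx_power fps_cplx_exp fps_cplx_bern F_def)
  hence "fps_nth (F ^ r * fps_exp (of_real t)) n = of_real (gen_bernoulli r n t) / fact n" for n
    by (simp add: fps_cplx_def gen_bernoulli_def)
  ultimately show ?thesis by simp
qed

lemma gen_bernoulli_1_0: "gen_bernoulli 1 n 0 = bernoulli_num n"
  by (simp add: gen_bernoulli_def bernoulli_num_def)

lemma bernoulli_num_sums:
  fixes x :: complex
  assumes "norm x < 2 * pi" "x \<noteq> 0"
  shows "(\<lambda>n. of_real (bernoulli_num n) / fact n * x ^ n) sums (x / (exp x - 1))"
  using gen_bernoulli_sums[OF assms, of 1 0] by (simp add: gen_bernoulli_1_0[unfolded One_nat_def])

end

theory Submission
  imports Defs
begin

text \<open>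
  Put \<open>N = 2m + 2\<close> and \<open>t = m + 1 = N/2\<close>, and let \<open>F = x / (exp x - 1)\<close>. At
  \<open>\<phi> = \<plusminus>2\<pi>i\<close> the even power of \<open>\<phi>\<close> in the \<open>k\<close>-th term combines with \<open>(2\<pi>i)\<^sup>2\<^sup>k\<close> to the constant
  \<open>(2\<pi>i)\<^sup>N\<close>, so that up to a constant factor the value is the sum of
  \<open>B\<^sub>j/j! \<cdot> B\<^bsub>N-j\<^esub>\<^bsup>(N)\<^esup>(t)/(N-j)!\<close> over the even \<open>j \<le> N\<close>. The function
  \<open>F\<^sup>N exp (t x) = (x / (2 sinh (x/2)))\<^sup>N\<close> is even, so the terms with odd \<open>j\<close> are zero and may be
  added. The full convolution is the coefficient of \<open>x\<^sup>N\<close> in \<open>F\<^bsup>N+1\<^esup> exp (t x)\<close>, i.e.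
  \<open>B\<^sub>N\<^bsup>(N+1)\<^esup>(t)/N!\<close>.

  This number vanishes because of a recurrence in the order (\<open>gen_bernoulli_raise_order\<close>), which
  expresses \<open>B\<^sub>n\<^bsup>(r+1)\<^esup>(t)\<close> by \<open>B\<^sub>n\<^bsup>(r)\<^esup>(t)\<close> with a factor \<open>r - n\<close> and by \<open>B\<^bsub>n-1\<^esub>\<^bsup>(r)\<^esup>(t)\<close>. For
  \<open>n = r = N\<close> the first term drops out, and the second is zero by the same
  evenness (\<open>gen_bernoulli_odd_at_centre\<close>), because \<open>N - 1\<close> is odd.
\<close>

definition bern_egf :: "real fps" where
  "bern_egf = fps_X / (fps_exp 1 - 1)"

lemma bern_egf_mult: "bern_egf * (fps_exp 1 - 1) = fps_X"
  unfolding bern_egf_def by (rule fps_bern_mult)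

lemma gen_bernoulli_egf: "gen_bernoulli r n t / fact n = fps_nth (bern_egf ^ r * fps_exp t) n"
  by (simp add: gen_bernoulli_def bern_egf_def)

lemma bernoulli_num_egf: "bernoulli_num n / fact n = fps_nth bern_egf n"
  by (simp add: bernoulli_num_def bern_egf_def)

text \<open>The product of the exponential generating functions of orders \<open>1\<close> and \<open>r\<close> has order \<open>r + 1\<close>.\<close>

lemma bernoulli_convolution:
  "(\<Sum>j\<le>n. bernoulli_num j / fact j * (gen_bernoulli r (n - j) t / fact (n - j))) =
     gen_bernoulli (Suc r) n t / fact n"
  unfolding gen_bernoulli_egf bernoulli_num_egf
  by (simp add: mult.assoc fps_mult_nth[of bern_egf] atLeast0AtMost)

text \<open>
  The series form of \<open>-x / (exp (-x) - 1) = x exp x / (exp x - 1)\<close>.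
\<close>

lemma bern_egf_compose_uminus: "bern_egf oo (- fps_X) = bern_egf * fps_exp 1"
proof -
  have "fps_exp (-1) * fps_exp 1 = (1 :: real fps)"
    by (simp flip: fps_exp_add_mult)
  have "(bern_egf oo (- fps_X)) * (fps_exp (-1) - 1) = (bern_egf * (fps_exp 1 - 1)) oo (- fps_X)"
    by (simp add: fps_compose_mult_distrib fps_compose_sub_distrib)
  also have "\<dots> = - (bern_egf * (fps_exp 1 - 1))"
    by (simp only: bern_egf_mult fps_X_fps_compose_startby0 fps_neg_nth fps_X_nth) simp
  also have "\<dots> = bern_egf * fps_exp 1 * (fps_exp (-1) - 1)"
    using \<open>fps_exp (-1) * fps_exp 1 = 1\<close> by (simp add: algebra_simps)
  finally have "(bern_egf oo (- fps_X)) * (fps_exp (-1) - 1) =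
      bern_egf * fps_exp 1 * (fps_exp (-1) - 1)" .
  moreover have "fps_nth (fps_exp (-1) - 1 :: real fps) 1 \<noteq> fps_nth 0 1" by simp
  hence "fps_exp (-1) - 1 \<noteq> (0 :: real fps)" by metis
  ultimately show ?thesis by (metis mult_right_cancel)
qed

lemma gen_bernoulli_reflect:
  "gen_bernoulli r n (real r - t) = (-1) ^ n * gen_bernoulli r n t"
proof -
  have "(bern_egf ^ r * fps_exp t) oo (- fps_X) = (bern_egf * fps_exp 1) ^ r * fps_exp (- t)"
    by (simp add: fps_compose_mult_distrib bern_egf_compose_uminus flip: fps_compose_power)
  also have "\<dots> = bern_egf ^ r * fps_exp (real r - t)"
    using fps_exp_add_mult[of "real r" "- t"]
    by (simp add: power_mult_distrib fps_exp_power_mult mult.assoc)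
  finally have "fps_nth (bern_egf ^ r * fps_exp (real r - t)) n =
      fps_nth ((bern_egf ^ r * fps_exp t) oo (- fps_X)) n"
    by simp
  also have "\<dots> = (-1) ^ n * fps_nth (bern_egf ^ r * fps_exp t) n"
    by (simp only: fps_compose_uminus' fps_nth_Abs_fps)
  finally have "gen_bernoulli r n (real r - t) / fact n = (-1) ^ n * (gen_bernoulli r n t / fact n)"
    by (simp only: gen_bernoulli_egf)
  thus ?thesis
    by (simp add: field_simps)
qed

text \<open>The centre of the reflection \<open>t \<mapsto> r - t\<close> is \<open>r/2\<close>.\<close>

lemma gen_bernoulli_odd_at_centre:
  assumes "odd n"
  shows "gen_bernoulli r n (real r / 2) = 0"
  using gen_bernoulli_reflect[of r n "real r / 2"] assms by (simp add: field_simps)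

text \<open>
  Differentiating \<open>F (exp x - 1) = x\<close> and multiplying by \<open>F\<close> turns every exponential into a
  polynomial in \<open>F\<close>, since \<open>F exp x = F + x\<close>.
\<close>

lemma bern_egf_square:
  "bern_egf * bern_egf = bern_egf - fps_X * bern_egf - fps_X * fps_deriv bern_egf"
proof -
  have e: "bern_egf * fps_exp 1 = bern_egf + fps_X"
    using bern_egf_mult by (simp add: algebra_simps)
  have "fps_deriv bern_egf * (fps_exp 1 - 1) + bern_egf * fps_exp 1 = 1"
    using arg_cong[OF bern_egf_mult, of fps_deriv] by (simp add: algebra_simps)
  hence "bern_egf * (fps_deriv bern_egf * (fps_exp 1 - 1) + bern_egf * fps_exp 1) = bern_egf"
    by simp
  hence "fps_deriv bern_egf * (bern_egf * (fps_exp 1 - 1)) + bern_egf * (bern_egf * fps_exp 1)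
      = bern_egf"
    by (simp only: distrib_left mult.left_commute)
  thus ?thesis
    unfolding bern_egf_mult e by (simp add: algebra_simps)
qed

text \<open>
  With \<open>A = F\<^sup>r exp (t x)\<close>, the formula for \<open>F\<^sup>2\<close> produces \<open>r x F\<^bsup>r-1\<^esup> F' exp (t x) = x (A' - t A)\<close>
  in \<open>r F A\<close>. Thus \<open>r F A = r A - r x A - x (A' - t A)\<close>, and the recurrence is the comparison of
  coefficients.
\<close>

lemma gen_bernoulli_raise_order:
  "real r * gen_bernoulli (Suc r) (Suc n) t =
     (real r - real (Suc n)) * gen_bernoulli r (Suc n) t
       + real (Suc n) * (t - real r) * gen_bernoulli r n t"
proof -
  define A where "A = bern_egf ^ r * fps_exp t"
  have deriv: "fps_deriv A =
      of_nat r * bern_egf ^ (r - 1) * fps_deriv bern_egf * fps_exp t + fps_const t * A"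
    by (simp add: A_def fps_deriv_power' algebra_simps)
  have "of_nat r * (bern_egf * A) =
      of_nat r * bern_egf ^ (r - 1) * (bern_egf * bern_egf) * fps_exp t"
    by (cases r) (simp_all add: A_def algebra_simps)
  also have "\<dots> = of_nat r * A - of_nat r * (fps_X * A)
      - fps_X * (of_nat r * bern_egf ^ (r - 1) * fps_deriv bern_egf * fps_exp t)"
    unfolding bern_egf_square by (cases r) (simp_all add: A_def algebra_simps)
  also have "\<dots> = of_nat r * A - of_nat r * (fps_X * A) - fps_X * (fps_deriv A - fps_const t * A)"
    by (simp add: deriv)
  finally have "fps_nth (fps_const (real r) * (bern_egf * A)) (Suc n) =
      fps_nth (fps_const (real r) * A - fps_const (real r) * (fps_X * A)
        - fps_X * (fps_deriv A - fps_const t * A)) (Suc n)"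
    by (simp add: fps_of_nat)
  hence "real r * fps_nth (bern_egf * A) (Suc n) = real r * fps_nth A (Suc n)
      - real r * fps_nth A n - (real (Suc n) * fps_nth A (Suc n) - t * fps_nth A n)"
    by simp
  hence rec: "real r * fps_nth (bern_egf * A) (Suc n) =
      (real r - real (Suc n)) * fps_nth A (Suc n) + (t - real r) * fps_nth A n"
    by (simp add: algebra_simps)
  have coeff: "gen_bernoulli r j t = fact j * fps_nth A j" for j
    by (simp add: A_def flip: gen_bernoulli_egf)
  have "gen_bernoulli (Suc r) (Suc n) t = fact (Suc n) * fps_nth (bern_egf * A) (Suc n)"
    using gen_bernoulli_egf[of "Suc r" "Suc n" t]
    by (simp add: A_def mult.assoc field_simps del: fact_Suc of_nat_Suc)
  hence "real r * gen_bernoulli (Suc r) (Suc n) t =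
      fact (Suc n) * (real r * fps_nth (bern_egf * A) (Suc n))"
    by (simp only: mult.left_commute)
  thus ?thesis
    unfolding rec coeff by (simp add: algebra_simps)
qed

text \<open>
  The recurrence with \<open>r = n\<close>: one coefficient is \<open>n - n\<close>, and the other multiplies a number of odd
  index at the centre \<open>n/2\<close>.
\<close>

lemma gen_bernoulli_even_diagonal:
  assumes "even n" "n > 0"
  shows "gen_bernoulli (Suc n) n (real n / 2) = 0"
proof -
  obtain l where l: "n = Suc l" using assms(2) gr0_implies_Suc by blast
  hence "gen_bernoulli n l (real n / 2) = 0"
    using assms(1) by (intro gen_bernoulli_odd_at_centre) simp
  thus ?thesis
    using gen_bernoulli_raise_order[of n l "real n / 2"] by (simp add: l)
qed

text \<open>
  A sum over even indices only, yet equal to the full convolution: for odd \<open>j\<close> the index \<open>N - j\<close> is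
  odd, so the second factor is zero at the centre.
\<close>

lemma even_bernoulli_convolution_at_centre:
  "(\<Sum>k = 0..m + 1. bernoulli_num (2 * k) / fact (2 * k) *
      (gen_bernoulli (2 * m + 2) (2 * m + 2 - 2 * k) (real m + 1) / fact (2 * m + 2 - 2 * k))) = 0"
proof -
  define N where "N = 2 * m + 2"
  define f where "f j = bernoulli_num j / fact j *
    (gen_bernoulli N (N - j) (real N / 2) / fact (N - j))" for j
  have centre: "real m + 1 = real N / 2" by (simp add: N_def)
  have "(\<Sum>k = 0..m + 1. f (2 * k)) = (\<Sum>j\<in>(*) 2 ` {0..m + 1}. f j)"
    by (simp add: sum.reindex inj_on_def)
  also have "\<dots> = (\<Sum>j\<le>N. f j)"
  proof (rule sum.mono_neutral_left)
    show "\<forall>j\<in>{..N} - (*) 2 ` {0..m + 1}. f j = 0"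
    proof
      fix j assume j: "j \<in> {..N} - (*) 2 ` {0..m + 1}"
      hence "odd j" by (auto simp: N_def elim!: evenE)
      hence "odd (N - j)" using j by (simp add: N_def)
      thus "f j = 0" by (simp add: f_def gen_bernoulli_odd_at_centre)
    qed
  qed (auto simp: N_def)
  also have "\<dots> = gen_bernoulli (Suc N) N (real N / 2) / fact N"
    unfolding f_def by (rule bernoulli_convolution)
  also have "\<dots> = 0"
    by (simp add: gen_bernoulli_even_diagonal N_def del: of_nat_Suc of_nat_add)
  finally show ?thesis
    unfolding centre f_def N_def[symmetric] .
qed

text \<open>Only even powers of \<open>\<phi>\<close> occur, so \<open>2\<pi>i\<close> and \<open>-2\<pi>i\<close> can be treated together through \<open>\<phi>\<^sup>2\<close>.\<close>

lemma poly_calB_eq_0: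
  assumes "\<phi> ^ 2 = (2 * of_real pi * \<i>) ^ 2"
  shows "poly (calB m) \<phi> = 0"
proof -
  define c where "c k = bernoulli_num (2 * k) / fact (2 * k) *
    (gen_bernoulli (2 * m + 2) (2 * m + 2 - 2 * k) (real m + 1) / fact (2 * m + 2 - 2 * k))" for k
  let ?z = "2 * of_real pi * \<i>"
  have pow: "?z ^ (2 * k) * \<phi> ^ (2 * m + 2 - 2 * k) = ?z ^ (2 * m + 2)"
    if "k \<le> m + 1" for k
  proof -
    have "2 * m + 2 - 2 * k = 2 * (m + 1 - k)" by simp
    hence "\<phi> ^ (2 * m + 2 - 2 * k) = ?z ^ (2 * m + 2 - 2 * k)"
      by (simp only: power_mult assms)
    thus ?thesis using that by (simp flip: power_add)
  qed
  have "poly (calB m) \<phi> = - (2 ^ (2 * m + 1)) *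
      (\<Sum>k = 0..m + 1. ?z ^ (2 * k) * \<phi> ^ (2 * m + 2 - 2 * k) * of_real (c k))"
    unfolding poly_calB c_def by (simp add: mult_ac)
  also have "(\<Sum>k = 0..m + 1. ?z ^ (2 * k) * \<phi> ^ (2 * m + 2 - 2 * k) * of_real (c k)) =
      (\<Sum>k = 0..m + 1. ?z ^ (2 * m + 2) * of_real (c k))"
    by (intro sum.cong refl) (simp only: pow atLeastAtMost_iff)
  also have "\<dots> = ?z ^ (2 * m + 2) * of_real (\<Sum>k = 0..m + 1. c k)"
    by (simp only: of_real_sum sum_distrib_left)
  also have "(\<Sum>k = 0..m + 1. c k) = 0"
    unfolding c_def by (rule even_bernoulli_convolution_at_centre)
  finally show ?thesis by simp
qed

theorem corollary5p4:
  fixes m :: nat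
  shows "poly (calB m) (2 * of_real pi * \<i>) = 0 \<and> poly (calB m) (- (2 * of_real pi * \<i>)) = 0"
  by (intro conjI poly_calB_eq_0 refl power2_minus)

end
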